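(* Let $k\in\mathbb{Z}_{\ge 0}$ and $n\in\mathbb{Z}_{\ge 1}$. For each $\lambda\in\Lambda_{k,S_n}$, there is a bijection between the set of vacillating tableaux of shape $\lambda$ and length $k$ and the set of set-partition tableaux of shape $\lambda$ and content $\{0^{n-t},1,\dots,k\}$ for some $t$ such that $|\lambda^\#|\le t\le n$ (i.e. the union over all such $t$).
   Context: $\Lambda_{k,S_n}$ is the set of partitions $\lambda\vdash n$ such that the irreducible $S_n$-module $S_n^\lambda$ (over a field $\mathbb{F}$ of characteristic zero) occurs in $M_n^{\otimes k}$, where $M_n$ is the $n$-dimensional permutation module of $S_n$ ($M_n^{\otimes 0}=\mathbb{F}$, the trivial module). For $\lambda\vdash n$, $\lambda^\#$ is the partition obtained by removing one copy of the largest part $\lambda_1$, so $|\lambda^\#|=n-\lambda_1$. $[m]$ is the one-part partition of $m$ ($[0]=\emptyset$). A vacillating tableau of shape $\lambda$ and length $k$ is a sequence $(\lambda^{(0)}=[n],\lambda^{(1/2)},\lambda^{(1)},\dots,\lambda^{(k-1/2)},\lambda^{(k)}=\lambda)$ in which each $\lambda^{(i)}$ ($i$ an integer) is a partition of $n$, each $\lambda^{(i+1/2)}$ is a partition of $n-1$ obtained from $\lambda^{(i)}$ by removing a box, and $\lambda^{(i+1)}$ is obtained from $\lambda^{(i+1/2)}$ by adding a box, for integers $0\le i<k$. Let $|\lambda^\#|\le t\le n$. A set-partition tableau of shape $\lambda$ and content $\{0^{n-t},1,\dots,k\}$ is a filling of the boxes of the Young diagram of $\lambda$ such that: (1) the first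 $n-t$ boxes of the first row are filled with $0$; (2) the boxes of the skew shape $\lambda/[n-t]$ are filled with numbers of $\{1,\dots,k\}$ so that the sets of entries in the boxes of $\lambda/[n-t]$ are the $t$ blocks of a set partition of $\{1,\dots,k\}$; (3) the boxes of $\lambda/[n-t]$ strictly increase across rows (left to right) and down columns, where $b_1<b_2$ means $\max(b_1)<\max(b_2)$ for the maximum entries. *)

theory Defs
  imports
    Complex_Main
    "HOL-Library.Function_Algebras"
    "HOL-Library.FuncSet"
    "HOL-Library.Disjoint_Sets"
    "HOL-Combinatorics.Permutations"
begin

section \<open>Partitions and Young diagrams\<close>

definition partitions_of :: "nat \<Rightarrow> nat list set" where
  "partitions_of n = {lam. sorted_wrt (\<ge>) lam \<and> 0 \<notin> set lam \<and> sum_list lam = n}"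

text \<open>The partition \<open>[m]\<close>, with \<open>[0]\<close> the empty partition.\<close>

definition one_part :: "nat \<Rightarrow> nat list" where
  "one_part m = (if m = 0 then [] else [m])"

text \<open>The partition \<open>lam\<^sup>#\<close>: one copy of the largest part is removed.\<close>

definition sharp :: "nat list \<Rightarrow> nat list" where
  "sharp lam = tl lam"

text \<open>Boxes are pairs (row, column), both counted from 0, in English notation.\<close>

definition young_diagram :: "nat list \<Rightarrow> (nat \<times> nat) set" where
  "young_diagram lam = {(i, j). i < length lam \<and> j < lam ! i}"

definition remove_box :: "nat list \<Rightarrow> nat list \<Rightarrow> bool" where
  "remove_box lam \<mu> \<longleftrightarrow> (\<exists>b\<in>young_diagram lam. young_diagram \<mu> = young_diagram lam - {b})"

definition add_box :: "nat list \<Rightarrow> nat list \<Rightarrow> bool" where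
  "add_box \<mu> lam \<longleftrightarrow> (\<exists>b. b \<notin> young_diagram \<mu> \<and> young_diagram lam = insert b (young_diagram \<mu>))"

section \<open>Representations of the symmetric group\<close>

text \<open>
  \<open>S\<^sub>n\<close> is the group of all \<open>\<sigma>\<close> with \<open>\<sigma> permutes {1..n}\<close>. All modules are subspaces of
  spaces of functions \<open>'x \<Rightarrow> 'f\<close>, where the function \<open>f\<close> stands for the formal linear
  combination of the points \<open>x\<close> with coefficients \<open>f x\<close>. If permutations act on the points
  by \<open>act\<close>, then \<open>lin_act act \<sigma>\<close> is the linear extension: it maps the basis vector of \<open>x\<close>
  to that of \<open>act \<sigma> x\<close>.
\<close>

definition fscale :: "'f::field \<Rightarrow> ('x \<Rightarrow> 'f) \<Rightarrow> 'x \<Rightarrow> 'f" where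
  "fscale c f = (\<lambda>x. c * f x)"

lemma vector_space_fscale: "vector_space fscale"
  by unfold_locales (auto simp: fscale_def fun_eq_iff algebra_simps)

definition lin_act ::
  "((nat \<Rightarrow> nat) \<Rightarrow> 'x \<Rightarrow> 'x) \<Rightarrow> (nat \<Rightarrow> nat) \<Rightarrow> ('x \<Rightarrow> 'f) \<Rightarrow> 'x \<Rightarrow> 'f" where
  "lin_act act \<sigma> f = (\<lambda>x. f (act (inv \<sigma>) x))"

text \<open>
  \<open>U\<close> occurs in \<open>V\<close> if some submodule of \<open>V\<close> is isomorphic to \<open>U\<close>, i.e. if there is an
  injective homomorphism of \<open>S\<^sub>n\<close>-modules from \<open>U\<close> to \<open>V\<close>.
\<close>

definition occurs_in ::
  "nat \<Rightarrow> ('x \<Rightarrow> 'f::field) set \<Rightarrow> ((nat \<Rightarrow> nat) \<Rightarrow> ('x \<Rightarrow> 'f) \<Rightarrow> 'x \<Rightarrow> 'f) \<Rightarrow>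
    ('y \<Rightarrow> 'f) set \<Rightarrow> ((nat \<Rightarrow> nat) \<Rightarrow> ('y \<Rightarrow> 'f) \<Rightarrow> 'y \<Rightarrow> 'f) \<Rightarrow> bool" where
  "occurs_in n U actU V actV \<longleftrightarrow>
    (\<exists>\<phi>. \<phi> ` U \<subseteq> V \<and> inj_on \<phi> U \<and>
      (\<forall>u\<in>U. \<forall>v\<in>U. \<phi> (u + v) = \<phi> u + \<phi> v) \<and>
      (\<forall>c. \<forall>u\<in>U. \<phi> (fscale c u) = fscale c (\<phi> u)) \<and>
      (\<forall>\<sigma>. \<sigma> permutes {1..n} \<longrightarrow> (\<forall>u\<in>U. \<phi> (actU \<sigma> u) = actV \<sigma> (\<phi> u))))"

subsection \<open>Tensor powers of the permutation module\<close>

definition perm_module :: "nat \<Rightarrow> (nat \<Rightarrow> 'f::field) set" where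
  "perm_module n = {f. \<forall>i. i \<notin> {1..n} \<longrightarrow> f i = 0}"

definition perm_module_act :: "(nat \<Rightarrow> nat) \<Rightarrow> (nat \<Rightarrow> 'f) \<Rightarrow> nat \<Rightarrow> 'f" where
  "perm_module_act = lin_act (\<lambda>\<sigma>. \<sigma>)"

text \<open>
  The word \<open>[i\<^sub>1, \<dots>, i\<^sub>k]\<close> indexes the basis vector of the tensor power given by the tensor
  product of the basis vectors with indices \<open>i\<^sub>1, \<dots>, i\<^sub>k\<close>. The \<open>0\<close>-th tensor power is spanned
  by the indicator function of the empty word, so it is the trivial module.
\<close>

definition pure_tensor :: "(nat \<Rightarrow> 'f::field) list \<Rightarrow> nat list \<Rightarrow> 'f" where
  "pure_tensor vs = (\<lambda>w. if length w = length vs then \<Prod>i<length vs. (vs ! i) (w ! i) else 0)"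

definition tensor_power :: "nat \<Rightarrow> nat \<Rightarrow> (nat list \<Rightarrow> 'f::field) set" where
  "tensor_power n k =
    module.span fscale (pure_tensor ` {vs. length vs = k \<and> set vs \<subseteq> perm_module n})"

definition tensor_power_act :: "(nat \<Rightarrow> nat) \<Rightarrow> (nat list \<Rightarrow> 'f) \<Rightarrow> nat list \<Rightarrow> 'f" where
  "tensor_power_act = lin_act map"

lemma tensor_power_act_pure_tensor:
  "tensor_power_act \<sigma> (pure_tensor vs) = pure_tensor (map (perm_module_act \<sigma>) vs)"
  by (auto simp: tensor_power_act_def perm_module_act_def lin_act_def pure_tensor_def fun_eq_iff
      intro!: prod.cong)

subsection \<open>The irreducible modules\<close>

text \<open>
  The irreducible module labelled by \<open>lam\<close> is the Specht module: the span of the polytabloids of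
  the tableaux of shape \<open>lam\<close>, with the convention that \<open>[n]\<close> labels the trivial module. A
  tabloid is represented as the list of the sets of entries of its rows.
\<close>

type_synonym tabloid = "nat set list"

definition young_tableaux :: "nat \<Rightarrow> nat list \<Rightarrow> (nat \<times> nat \<Rightarrow> nat) set" where
  "young_tableaux n lam = {t. bij_betw t (young_diagram lam) {1..n}}"

definition tabloid_of :: "nat list \<Rightarrow> (nat \<times> nat \<Rightarrow> nat) \<Rightarrow> tabloid" where
  "tabloid_of lam t = map (\<lambda>i. t ` {b \<in> young_diagram lam. fst b = i}) [0..<length lam]"

definition column_stabilizer :: "nat \<Rightarrow> nat list \<Rightarrow> (nat \<times> nat \<Rightarrow> nat) \<Rightarrow> (nat \<Rightarrow> nat) set" where
  "column_stabilizer n lam t =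
    {\<pi>. \<pi> permutes {1..n} \<and>
      (\<forall>j. let C = t ` {b \<in> young_diagram lam. snd b = j} in \<pi> ` C = C)}"

definition polytabloid ::
  "nat \<Rightarrow> nat list \<Rightarrow> (nat \<times> nat \<Rightarrow> nat) \<Rightarrow> tabloid \<Rightarrow> 'f::field" where
  "polytabloid n lam t =
    (\<lambda>T. \<Sum>\<pi>\<in>column_stabilizer n lam t.
      of_int (sign \<pi>) * (if T = tabloid_of lam (\<pi> \<circ> t) then 1 else 0))"

definition specht_module :: "nat \<Rightarrow> nat list \<Rightarrow> (tabloid \<Rightarrow> 'f::field) set" where
  "specht_module n lam = module.span fscale (polytabloid n lam ` young_tableaux n lam)"

definition specht_act :: "(nat \<Rightarrow> nat) \<Rightarrow> (tabloid \<Rightarrow> 'f) \<Rightarrow> tabloid \<Rightarrow> 'f" where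
  "specht_act = lin_act (\<lambda>\<sigma>. map ((`) \<sigma>))"

text \<open>The set \<open>\<Lambda>\<close> of \<open>k\<close> and \<open>S\<^sub>n\<close>; the base field is the type \<open>'f\<close>.\<close>

definition Lambda_Sn :: "'f::field_char_0 itself \<Rightarrow> nat \<Rightarrow> nat \<Rightarrow> nat list set" where
  "Lambda_Sn F k n =
    {lam \<in> partitions_of n.
      occurs_in n (specht_module n lam :: (tabloid \<Rightarrow> 'f) set) specht_act
        (tensor_power n k :: (nat list \<Rightarrow> 'f) set) tensor_power_act}"

section \<open>Vacillating tableaux and set-partition tableaux\<close>

text \<open>Positions \<open>2 * i\<close> and \<open>2 * i + 1\<close> of \<open>v\<close> hold the partitions with indices \<open>i\<close> and \<open>i + 1/2\<close>.\<close>

definition vacillating_tableaux :: "nat \<Rightarrow> nat \<Rightarrow> nat list \<Rightarrow> nat list list set" where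
  "vacillating_tableaux n k lam =
    {v. length v = 2 * k + 1 \<and> v ! 0 = one_part n \<and> v ! (2 * k) = lam \<and>
      (\<forall>i\<le>k. v ! (2 * i) \<in> partitions_of n) \<and>
      (\<forall>i<k. v ! (2 * i + 1) \<in> partitions_of (n - 1) \<and>
        remove_box (v ! (2 * i)) (v ! (2 * i + 1)) \<and>
        add_box (v ! (2 * i + 1)) (v ! (2 * i + 2)))}"

text \<open>
  Fillings map boxes to sets of numbers; a box filled with the number \<open>0\<close> is mapped to \<open>{0}\<close>.
  They are \<open>undefined\<close> off the diagram.
\<close>

definition set_partition_tableaux ::
  "nat \<Rightarrow> nat \<Rightarrow> nat \<Rightarrow> nat list \<Rightarrow> (nat \<times> nat \<Rightarrow> nat set) set" where
  "set_partition_tableaux n k t lam =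
    (let skew = young_diagram lam - young_diagram (one_part (n - t)) in
      {T \<in> extensional (young_diagram lam).
        (\<forall>b\<in>young_diagram (one_part (n - t)). T b = {0}) \<and>
        (\<exists>P. partition_on {1..k} P \<and> card P = t \<and> bij_betw T skew P) \<and>
        (\<forall>i j j'. (i, j) \<in> skew \<longrightarrow> (i, j') \<in> skew \<longrightarrow> j < j' \<longrightarrow> Max (T (i, j)) < Max (T (i, j'))) \<and>
        (\<forall>i i' j. (i, j) \<in> skew \<longrightarrow> (i', j) \<in> skew \<longrightarrow> i < i' \<longrightarrow> Max (T (i, j)) < Max (T (i', j)))})"

end

theory Submission
  imports Defs "HOL-Combinatorics.Stirling"
begin

text \<open>
  Both sets are finite, so it suffices that they have the same number of elements. Let \<open>U\<close> and \<open>D\<close>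
  be the operators on formal linear combinations of Young diagrams that add, respectively remove,
  a box in all possible ways. A vacillating tableau alternates removals and additions, so the
  number of those of shape \<open>lam\<close> and length \<open>k\<close> is the coefficient of \<open>lam\<close> in \<open>(U D)\<^sup>k [n]\<close>
  (\<open>card_vacillating_tableaux\<close>).

  Since a diagram has one more place to add a box than to remove one, \<open>D U - U D\<close> is the identity
  (\<open>down_up_commute\<close>). As in every algebra with this commutation relation,
  \<open>(U D)\<^sup>k = (\<Sum>t. S(k, t) U\<^sup>t D\<^sup>t)\<close> with Stirling numbers of the second kind \<open>S(k, t)\<close>. Moreover
  \<open>D\<^sup>t [n] = [n - t]\<close> for \<open>t \<le> n\<close> and \<open>D\<^sup>t [n] = 0\<close> for \<open>t > n\<close>, so
  \<open>(U D)\<^sup>k [n] = (\<Sum>t\<le>n. S(k, t) U\<^sup>t [n - t])\<close> (\<open>up_down_pow_row\<close>).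

  The coefficient of \<open>lam\<close> in \<open>U\<^sup>t [n - t]\<close> counts the ways to build \<open>lam\<close> from \<open>[n - t]\<close> box by box,
  which are the standard tableaux of the skew shape \<open>lam / [n - t]\<close> (\<open>card_fillings\<close>). Distinct blocks
  of a set partition have distinct maxima, so for each of the \<open>S(k, t)\<close> set partitions of \<open>{1..k}\<close>
  into \<open>t\<close> blocks (\<open>card_partitions_Stirling\<close>) the set-partition tableaux with these blocks correspond
  to these standard tableaux. Hence the \<open>t\<close>-th summand counts the set-partition tableaux with \<open>t\<close>
  blocks (\<open>card_set_partition_tableaux\<close>).
\<close>

section \<open>Diagrams and their corners\<close>

definition diagram :: "(nat \<times> nat) set \<Rightarrow> bool" where
  "diagram D \<longleftrightarrow> finite D \<and>
    (\<forall>i j i' j'. (i, j) \<in> D \<longrightarrow> i' \<le> i \<longrightarrow> j' \<le> j \<longrightarrow> (i', j') \<in> D)"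

definition corners :: "(nat \<times> nat) set \<Rightarrow> (nat \<times> nat) set" where
  "corners D = {b \<in> D. diagram (D - {b})}"

definition outer_corners :: "(nat \<times> nat) set \<Rightarrow> (nat \<times> nat) set" where
  "outer_corners D = {b. b \<notin> D \<and> diagram (insert b D)}"

lemma diagram_finite: "diagram D \<Longrightarrow> finite D"
  by (simp add: diagram_def)

lemma diagram_down: "diagram D \<Longrightarrow> (i, j) \<in> D \<Longrightarrow> i' \<le> i \<Longrightarrow> j' \<le> j \<Longrightarrow> (i', j') \<in> D"
  unfolding diagram_def by blast

text \<open>
  Diagrams form a distributive lattice under union and intersection; the commutation relation
  below needs the covering relation of this lattice only through these two closure properties.
\<close>

lemma diagram_Int: "diagram D \<Longrightarrow> diagram E \<Longrightarrow> diagram (D \<inter> E)"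
  unfolding diagram_def by blast

lemma diagram_Un: "diagram D \<Longrightarrow> diagram E \<Longrightarrow> diagram (D \<union> E)"
  unfolding diagram_def by blast

lemma finite_down_set_eq_lessThan:
  fixes S :: "nat set"
  assumes "finite S" and down: "\<And>x y. x \<in> S \<Longrightarrow> y \<le> x \<Longrightarrow> y \<in> S"
  shows "S = {..<card S}"
proof (rule card_subset_eq[symmetric])
  show "finite S" by fact
  show "{..<card S} \<subseteq> S"
  proof
    fix y assume y: "y \<in> {..<card S}"
    show "y \<in> S"
    proof (rule ccontr)
      assume "y \<notin> S"
      with down have "S \<subseteq> {..<y}"
        by (metis lessThan_iff not_le_imp_less subsetI)
      then have "card S \<le> card {..<y}" by (intro card_mono) auto
      with y show False by simp
    qed
  qed
qed simp

text \<open>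
  The columns that meet a given row form an initial segment, so a diagram is the region under a
  weakly decreasing sequence of row lengths. This is what the count of corners and the passage
  back to lists of parts rely on.
\<close>

lemma diagram_row_lengths:
  assumes "diagram D"
  obtains r :: "nat \<Rightarrow> nat" where "antimono r" and "D = {(i, j). j < r i}"
proof
  let ?S = "\<lambda>i. {j. (i, j) \<in> D}"
  let ?r = "\<lambda>i. card (?S i)"
  have fin: "finite (?S i)" for i
    by (rule finite_subset[of _ "snd ` D"]) (use diagram_finite[OF assms] in force)+
  have "?S i = {..<?r i}" for i
    by (rule finite_down_set_eq_lessThan[OF fin]) (use diagram_down[OF assms] in auto)
  then show "D = {(i, j). j < ?r i}" by blast
  show "antimono ?r"
    by (intro antimonoI card_mono fin) (use diagram_down[OF assms] in auto)
qed

text \<open>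
  A box can be removed from row \<open>i\<close> exactly if row \<open>i + 1\<close> is strictly shorter, and exactly in that
  case a box can be added to row \<open>i + 1\<close>. The surplus outer corner is the one in row \<open>0\<close>, where a box
  can always be added.
\<close>

lemma card_outer_corners:
  assumes D: "diagram D"
  shows "finite (outer_corners D)" "card (outer_corners D) = Suc (card (corners D))"
proof -
  obtain r where r: "antimono r" and Dr: "D = {(i, j). j < r i}"
    using diagram_row_lengths[OF D] .
  have anti: "r i' \<le> r i" if "i \<le> i'" for i i' using r that by (rule antimonoD)
  have finD: "finite D" using D by (rule diagram_finite)
  let ?I = "{i. r (Suc i) < r i}"
  have C: "corners D = (\<lambda>i. (i, r i - 1)) ` ?I"
  proof (intro equalityI subsetI)
    fix b assume b: "b \<in> corners D"
    obtain i j where ij: "b = (i, j)" by force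
    have inD: "j < r i" and dia: "diagram (D - {(i, j)})"
      using b by (auto simp: corners_def ij Dr)
    have "(i, Suc j) \<notin> D" using diagram_down[OF dia, of i "Suc j" i j] by auto
    moreover have "(Suc i, j) \<notin> D" using diagram_down[OF dia, of "Suc i" j i j] by auto
    ultimately have "j = r i - 1" "r (Suc i) < r i" using inD by (auto simp: Dr)
    then show "b \<in> (\<lambda>i. (i, r i - 1)) ` ?I" by (auto simp: ij)
  next
    fix b assume "b \<in> (\<lambda>i. (i, r i - 1)) ` ?I"
    then obtain i where b: "b = (i, r i - 1)" and i: "r (Suc i) < r i" by auto
    have "diagram (D - {b})"
      unfolding diagram_def
    proof (intro conjI allI impI)
      fix x y x' y' assume xy: "(x, y) \<in> D - {b}" "x' \<le> x" "y' \<le> y"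
      have "(x', y') \<noteq> b"
      proof
        assume eq: "(x', y') = b"
        show False
        proof (cases "x = i")
          case True
          with xy eq show False by (auto simp: Dr b)
        next
          case False
          with xy eq have "Suc i \<le> x" by (auto simp: b)
          from anti[OF this] i xy eq show False by (auto simp: Dr b)
        qed
      qed
      then show "(x', y') \<in> D - {b}" using xy diagram_down[OF D] by blast
    qed (use finD in auto)
    then show "b \<in> corners D" using i by (auto simp: corners_def Dr b)
  qed
  let ?J = "insert 0 (Suc ` ?I)"
  have O: "outer_corners D = (\<lambda>i. (i, r i)) ` ?J"
  proof (intro equalityI subsetI)
    fix b assume b: "b \<in> outer_corners D"
    obtain i j where ij: "b = (i, j)" by force
    have nD: "r i \<le> j" and dia: "diagram (insert (i, j) D)"
      using b by (auto simp: outer_corners_def ij Dr)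
    have j: "j = r i"
    proof (rule ccontr)
      assume "j \<noteq> r i"
      then show False
        using diagram_down[OF dia, of i j i "r i"] nD by (auto simp: Dr)
    qed
    have "i \<in> ?J"
    proof (cases i)
      case (Suc m)
      then show ?thesis using diagram_down[OF dia, of i j m j] by (auto simp: Dr j)
    qed simp
    then show "b \<in> (\<lambda>i. (i, r i)) ` ?J" by (auto simp: ij j)
  next
    fix b assume "b \<in> (\<lambda>i. (i, r i)) ` ?J"
    then obtain i where b: "b = (i, r i)" and i: "i \<in> ?J" by auto
    have "diagram (insert b D)"
      unfolding diagram_def
    proof (intro conjI allI impI)
      fix x y x' y' assume xy: "(x, y) \<in> insert b D" "x' \<le> x" "y' \<le> y"
      show "(x', y') \<in> insert b D"
      proof (cases "(x, y) = b")
        case True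
        show ?thesis
        proof (cases "x' = i")
          case True
          with xy \<open>(x, y) = b\<close> show ?thesis by (auto simp: b Dr)
        next
          case False
          with xy \<open>(x, y) = b\<close> have "x' < i" by (auto simp: b)
          then obtain m where m: "i = Suc m" "x' \<le> m" "r (Suc m) < r m" using i by auto
          with anti[OF m(2)] xy \<open>(x, y) = b\<close> show ?thesis by (auto simp: b Dr)
        qed
      next
        case False
        then show ?thesis using xy diagram_down[OF D] by blast
      qed
    qed (use finD in auto)
    then show "b \<in> outer_corners D" by (auto simp: outer_corners_def Dr b)
  qed
  have "finite (corners D)" using finD by (auto simp: corners_def)
  then have finI: "finite ?I" unfolding C by (rule finite_imageD) (auto intro: inj_onI)
  show "finite (outer_corners D)" unfolding O using finI by simp
  show "card (outer_corners D) = Suc (card (corners D))"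
    unfolding O C using finI by (subst (1 2) card_image) (auto intro: inj_onI simp: card_image)
qed

lemma finite_corners: "diagram D \<Longrightarrow> finite (corners D)"
  using diagram_finite by (auto simp: corners_def)

section \<open>The up and down operators\<close>

text \<open>
  The up and down operators of Young's lattice, on functions that give the coefficient of each
  diagram in a formal linear combination. The operator \<open>up\<close> adds a box to every diagram, so the new
  coefficient of \<open>D\<close> collects the old coefficients of the diagrams one box smaller.
\<close>

definition up :: "((nat \<times> nat) set \<Rightarrow> nat) \<Rightarrow> (nat \<times> nat) set \<Rightarrow> nat" where
  "up g D = (\<Sum>b\<in>corners D. g (D - {b}))"

definition down :: "((nat \<times> nat) set \<Rightarrow> nat) \<Rightarrow> (nat \<times> nat) set \<Rightarrow> nat" where
  "down g D = (\<Sum>b\<in>outer_corners D. g (insert b D))"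

lemma corners_diagram: "b \<in> corners D \<Longrightarrow> diagram (D - {b})"
  by (simp add: corners_def)

lemma outer_corners_diagram: "b \<in> outer_corners D \<Longrightarrow> diagram (insert b D)"
  by (simp add: outer_corners_def)

text \<open>
  Both operators evaluate their argument at diagrams only, so identities that hold merely at
  diagrams, such as the commutation relation, can be used below further operators.
\<close>

lemma up_cong: "(\<And>E. diagram E \<Longrightarrow> g E = h E) \<Longrightarrow> up g D = up h D"
  unfolding up_def by (intro sum.cong refl) (simp add: corners_diagram)

lemma down_cong: "(\<And>E. diagram E \<Longrightarrow> g E = h E) \<Longrightarrow> down g D = down h D"
  unfolding down_def by (intro sum.cong refl) (simp add: outer_corners_diagram)

text \<open>
  This is the relation that makes Young's lattice a differential poset. The paths from \<open>D\<close> that add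
  \<open>b\<close> and remove \<open>c \<noteq> b\<close> pass through \<open>D \<union> {b}\<close> in one order and through \<open>D - {c}\<close> in the other; the two
  kinds match because diagrams are closed under intersection and union. The paths that return to
  \<open>D\<close> are counted by outer corners in one order and by corners in the other, and these counts differ
  by one.
\<close>

lemma down_up_commute:
  assumes D: "diagram D"
  shows "down (up g) D = up (down g) D + g D"
proof -
  let ?O = "outer_corners D" and ?C = "corners D"
  let ?X = "Sigma ?O (\<lambda>b. corners (insert b D) - {b})"
  let ?Y = "Sigma ?C (\<lambda>c. outer_corners (D - {c}) - {c})"
  have down: "up g (insert b D) = g D + (\<Sum>c\<in>corners (insert b D) - {b}. g (insert b D - {c}))"
    if "b \<in> ?O" for b
  proof -
    have "b \<in> corners (insert b D)" "insert b D - {b} = D"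
      using that D by (auto simp: corners_def outer_corners_def)
    then show ?thesis
      unfolding up_def using finite_corners[OF outer_corners_diagram[OF that]]
      by (simp add: sum.remove)
  qed
  have up: "down g (D - {c}) = g D + (\<Sum>b\<in>outer_corners (D - {c}) - {c}. g (insert b (D - {c})))"
    if "c \<in> ?C" for c
  proof -
    have "c \<in> outer_corners (D - {c})" "insert c (D - {c}) = D"
      using that D by (auto simp: corners_def outer_corners_def insert_absorb)
    then show ?thesis
      unfolding down_def using card_outer_corners(1)[OF corners_diagram[OF that]]
      by (simp add: sum.remove)
  qed
  have swap: "(b, c) \<in> ?X \<longleftrightarrow> (c, b) \<in> ?Y" for b c
  proof
    assume "(b, c) \<in> ?X"
    then have h: "b \<notin> D" "diagram (insert b D)" "c \<in> D" "c \<noteq> b" "diagram (insert b D - {c})"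
      by (auto simp: corners_def outer_corners_def)
    have "D - {c} = D \<inter> (insert b D - {c})" "insert b (D - {c}) = insert b D - {c}"
      using h by auto
    with h show "(c, b) \<in> ?Y"
      using diagram_Int[OF D h(5)] by (auto simp: corners_def outer_corners_def)
  next
    assume "(c, b) \<in> ?Y"
    then have h: "c \<in> D" "diagram (D - {c})" "b \<notin> D" "b \<noteq> c" "diagram (insert b (D - {c}))"
      by (auto simp: corners_def outer_corners_def)
    have "insert b D = D \<union> insert b (D - {c})" "insert b D - {c} = insert b (D - {c})"
      using h by auto
    with h show "(b, c) \<in> ?X"
      using diagram_Un[OF D h(5)] by (auto simp: corners_def outer_corners_def)
  qed
  have fin: "\<forall>b\<in>?O. finite (corners (insert b D) - {b})"
    "\<forall>c\<in>?C. finite (outer_corners (D - {c}) - {c})"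
    using finite_corners outer_corners_diagram card_outer_corners(1) corners_diagram by blast+
  have "(\<Sum>b\<in>?O. \<Sum>c\<in>corners (insert b D) - {b}. g (insert b D - {c}))
      = (\<Sum>(b, c)\<in>?X. g (insert b D - {c}))"
    by (rule sum.Sigma[OF card_outer_corners(1)[OF D] fin(1)])
  also have "\<dots> = (\<Sum>(c, b)\<in>?Y. g (insert b (D - {c})))"
  proof (rule sum.reindex_bij_witness[where i = prod.swap and j = prod.swap])
    fix p assume p: "p \<in> ?X"
    obtain b c where [simp]: "p = (b, c)" by (cases p)
    have "c \<noteq> b" using p by auto
    then have "insert b (D - {c}) = insert b D - {c}" by auto
    then show "(case prod.swap p of (c, b) \<Rightarrow> g (insert b (D - {c})))
      = (case p of (b, c) \<Rightarrow> g (insert b D - {c}))" by simp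
  next
    fix p assume "p \<in> ?X" then show "prod.swap p \<in> ?Y" using swap by (cases p) simp
  next
    fix p assume "p \<in> ?Y" then show "prod.swap p \<in> ?X" using swap by (cases p) simp
  qed auto
  also have "\<dots> = (\<Sum>c\<in>?C. \<Sum>b\<in>outer_corners (D - {c}) - {c}. g (insert b (D - {c})))"
    by (rule sum.Sigma[OF finite_corners[OF D] fin(2), symmetric])
  finally have eq: "(\<Sum>b\<in>?O. \<Sum>c\<in>corners (insert b D) - {b}. g (insert b D - {c})) = \<dots>" .
  have "down (up g) D
      = card ?O * g D + (\<Sum>b\<in>?O. \<Sum>c\<in>corners (insert b D) - {b}. g (insert b D - {c}))"
    unfolding down_def[of "up g"] by (simp add: down sum.distrib)
  moreover have "up (down g) D
      = card ?C * g D + (\<Sum>c\<in>?C. \<Sum>b\<in>outer_corners (D - {c}) - {c}. g (insert b (D - {c})))"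
    unfolding up_def[of "down g"] by (simp add: up sum.distrib)
  ultimately show ?thesis using eq card_outer_corners(2)[OF D] by simp
qed

lemma up_add_mult: "up (\<lambda>E. g E + c * h E) D = up g D + c * up h D"
  by (simp add: up_def sum.distrib sum_distrib_left)

lemma up_sum_mult: "up (\<lambda>E. \<Sum>t\<in>S. c t * g t E) D = (\<Sum>t\<in>S. c t * up (g t) D)"
  unfolding up_def by (subst sum.swap) (simp add: sum_distrib_left)

lemma down_sum_mult: "down (\<lambda>E. \<Sum>t\<in>S. c t * g t E) = (\<lambda>D. \<Sum>t\<in>S. c t * down (g t) D)"
  unfolding down_def by (rule ext, subst sum.swap) (simp add: sum_distrib_left)

text \<open>
  Moving \<open>down\<close> to the right across \<open>t\<close> factors \<open>up\<close> leaves one commutator per factor, as for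
  differentiation and multiplication by a variable.
\<close>

lemma down_up_pow:
  assumes "diagram D"
  shows "down ((up ^^ t) g) D = (up ^^ t) (down g) D + t * (up ^^ (t - 1)) g D"
  using assms
proof (induction t arbitrary: D)
  case (Suc t)
  have "up (down ((up ^^ t) g)) D = up (\<lambda>E. (up ^^ t) (down g) E + t * (up ^^ (t - 1)) g E) D"
    by (rule up_cong) (rule Suc.IH)
  also have "\<dots> = (up ^^ Suc t) (down g) D + t * (up ^^ t) g D"
    unfolding up_add_mult by (cases t) simp_all
  finally show ?case using down_up_commute[OF Suc.prems, of "(up ^^ t) g"] by simp
qed simp

lemma up_pow_cong:
  assumes "\<And>E. diagram E \<Longrightarrow> g E = h E" and "diagram D"
  shows "(up ^^ t) g D = (up ^^ t) h D"
  using assms(2)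
proof (induction t arbitrary: D)
  case (Suc t)
  have "up ((up ^^ t) g) D = up ((up ^^ t) h) D" by (rule up_cong) (rule Suc.IH)
  then show ?case by simp
qed (simp add: assms(1))

lemma up_pow_zero: "(up ^^ t) (\<lambda>E. 0) D = 0"
  by (induction t arbitrary: D) (simp_all add: up_def)

abbreviation delta :: "(nat \<times> nat) set \<Rightarrow> (nat \<times> nat) set \<Rightarrow> nat" where
  "delta A D \<equiv> of_bool (D = A)"

definition row :: "nat \<Rightarrow> (nat \<times> nat) set" where
  "row m = {0} \<times> {..<m}"

lemma mem_row [simp]: "(i, j) \<in> row m \<longleftrightarrow> i = 0 \<and> j < m"
  by (auto simp: row_def)

lemma diagram_row: "diagram (row m)"
  unfolding diagram_def by (auto simp: row_def)

text \<open>
  The only box whose removal from a one-row diagram leaves a diagram is its last one.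
\<close>

lemma down_delta_row:
  assumes D: "diagram D"
  shows "down (delta (row m)) D = (if m = 0 then 0 else delta (row (m - 1)) D)"
proof (cases m)
  case 0
  then show ?thesis by (simp add: down_def row_def)
next
  case (Suc l)
  have ins: "insert (0, l) (row l) = row m" by (auto simp: Suc row_def)
  have iff: "b \<in> outer_corners D \<and> insert b D = row m \<longleftrightarrow> b = (0, l) \<and> D = row l" for b
  proof
    assume b: "b \<in> outer_corners D \<and> insert b D = row m"
    then have "b \<in> row m" and bD: "b \<notin> D" by (auto simp: outer_corners_def)
    then obtain j where j: "b = (0, j)" "j \<le> l"
      by (cases b) (simp add: Suc less_Suc_eq_le)
    have "\<not> j < l"
    proof
      assume "j < l"
      have "(0, l) \<in> row m" by (simp add: Suc)
      then have "(0, l) \<in> insert b D" using b by blast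
      then have "(0, l) \<in> D" using j \<open>j < l\<close> by simp
      from diagram_down[OF D this, of 0 j] \<open>j < l\<close> bD j show False by auto
    qed
    then have bl: "b = (0, l)" using j by simp
    moreover have "D = row m - {b}" using b bD by blast
    moreover have "row m - {(0, l)} = row l" by (auto simp: Suc row_def)
    ultimately show "b = (0, l) \<and> D = row l" by metis
  next
    assume b: "b = (0, l) \<and> D = row l"
    then have "insert b D = row m" using ins by metis
    moreover have "b \<notin> D" using b by simp
    ultimately show "b \<in> outer_corners D \<and> insert b D = row m"
      unfolding outer_corners_def using diagram_row[of m] by (metis mem_Collect_eq)
  qed
  note fin = card_outer_corners(1)[OF D]
  have "down (delta (row m)) D = card (outer_corners D \<inter> {b. insert b D = row m})"
    by (simp only: down_def sum_of_bool_eq[OF fin fin] of_nat_id)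
  also have "outer_corners D \<inter> {b. insert b D = row m} = (if D = row l then {(0, l)} else {})"
  proof (rule set_eqI)
    fix b
    show "b \<in> outer_corners D \<inter> {b. insert b D = row m}
        \<longleftrightarrow> b \<in> (if D = row l then {(0, l)} else {})"
      unfolding Int_iff mem_Collect_eq iff by (cases "D = row l") simp_all
  qed
  finally show ?thesis using Suc by simp
qed

text \<open>
  The normal ordering of \<open>(up down)\<^sup>k\<close> has the Stirling numbers of the second kind as coefficients:
  the commutation relation turns \<open>up down up\<^sup>t down\<^sup>t\<close> into \<open>up\<^sup>t\<^sup>+\<^sup>1 down\<^sup>t\<^sup>+\<^sup>1 + t up\<^sup>t down\<^sup>t\<close>, which matches the
  recursion \<open>S(k + 1, t) = S(k, t - 1) + t S(k, t)\<close>. Applied to the row of length \<open>n\<close>, the factor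
  \<open>down\<^sup>t\<close> gives the row of length \<open>n - t\<close>, and \<open>0\<close> for \<open>t > n\<close>.
\<close>

lemma up_down_pow_row:
  assumes "diagram D"
  shows "((\<lambda>g. up (down g)) ^^ k) (delta (row n)) D
    = (\<Sum>t\<le>n. Stirling k t * (up ^^ t) (delta (row (n - t))) D)"
  using assms
proof (induction k arbitrary: D)
  case 0
  have "(\<Sum>t\<le>n. Stirling 0 t * (up ^^ t) (delta (row (n - t))) D)
      = (\<Sum>t\<in>{0}. Stirling 0 t * (up ^^ t) (delta (row (n - t))) D)"
    by (rule sum.mono_neutral_right) (auto simp: neq0_conv elim!: lessE)
  then show ?case by simp
next
  case (Suc k)
  let ?X = "\<lambda>t. (up ^^ t) (delta (row (n - t)))"
  let ?F = "((\<lambda>g. up (down g)) ^^ k) (delta (row n))"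
  have step: "up (down (?X t)) D = (if t < n then ?X (Suc t) D else 0) + t * ?X t D" for t
  proof -
    have "up (down (?X t)) D
        = up (\<lambda>E. (up ^^ t) (down (delta (row (n - t)))) E
            + t * (up ^^ (t - 1)) (delta (row (n - t))) E) D"
      by (rule up_cong) (rule down_up_pow)
    also have "\<dots> = (up ^^ Suc t) (down (delta (row (n - t)))) D + t * ?X t D"
      unfolding up_add_mult by (cases t) simp_all
    also have "(up ^^ Suc t) (down (delta (row (n - t)))) D = (if t < n then ?X (Suc t) D else 0)"
    proof (cases "t < n")
      case True
      have "(up ^^ Suc t) (down (delta (row (n - t)))) D = ?X (Suc t) D"
        by (rule up_pow_cong) (use True Suc.prems in \<open>simp_all add: down_delta_row\<close>)
      then show ?thesis using True by simp
    next
      case False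
      have "(up ^^ Suc t) (down (delta (row (n - t)))) D = (up ^^ Suc t) (\<lambda>E. 0) D"
        by (rule up_pow_cong) (use False Suc.prems in \<open>simp_all add: down_def row_def\<close>)
      then show ?thesis using False up_pow_zero[of "Suc t" D] by argo
    qed
    finally show ?thesis .
  qed
  have shift: "(\<Sum>t\<le>n. if t < n then Stirling k t * ?X (Suc t) D else 0)
      = (\<Sum>t\<le>n. if t = 0 then 0 else Stirling k (t - 1) * ?X t D)"
  proof -
    have "(\<Sum>t\<le>n. if t < n then Stirling k t * ?X (Suc t) D else 0)
        = (\<Sum>t<n. Stirling k t * ?X (Suc t) D)"
      by (intro sum.mono_neutral_cong_right) auto
    then show ?thesis unfolding sum.atMost_shift by simp
  qed
  have dist: "s * ((if t < n then x else 0) + t * y) = (if t < n then s * x else 0) + t * s * y"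
    for s t x y :: nat
    by (simp add: algebra_simps)
  have rec: "(if t = 0 then 0 else Stirling k (t - 1) * x) + t * Stirling k t * x
      = Stirling (Suc k) t * x" for t x
    by (cases t) (simp_all add: algebra_simps)
  have "((\<lambda>g. up (down g)) ^^ Suc k) (delta (row n)) D = up (down ?F) D" by simp
  also have "\<dots> = up (down (\<lambda>E. \<Sum>t\<le>n. Stirling k t * ?X t E)) D"
    by (rule up_cong, rule down_cong, rule Suc.IH)
  also have "\<dots> = (\<Sum>t\<le>n. Stirling k t * up (down (?X t)) D)"
    by (simp only: down_sum_mult up_sum_mult)
  also have "\<dots> = (\<Sum>t\<le>n. (if t < n then Stirling k t * ?X (Suc t) D else 0)
      + t * Stirling k t * ?X t D)"
    unfolding step by (intro sum.cong refl) (rule dist)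
  also have "\<dots> = (\<Sum>t\<le>n. if t < n then Stirling k t * ?X (Suc t) D else 0)
      + (\<Sum>t\<le>n. t * Stirling k t * ?X t D)"
    by (rule sum.distrib)
  also have "\<dots> = (\<Sum>t\<le>n. if t = 0 then 0 else Stirling k (t - 1) * ?X t D)
      + (\<Sum>t\<le>n. t * Stirling k t * ?X t D)"
    by (rule arg_cong[OF shift])
  also have "\<dots> = (\<Sum>t\<le>n. (if t = 0 then 0 else Stirling k (t - 1) * ?X t D)
      + t * Stirling k t * ?X t D)"
    by (rule sum.distrib[symmetric])
  also have "\<dots> = (\<Sum>t\<le>n. Stirling (Suc k) t * ?X t D)"
    by (intro sum.cong refl) (rule rec)
  finally show ?case .
qed

section \<open>Counting set partitions\<close>

text \<open>
  The maximum of a block lies in the block, and blocks are disjoint. This makes the order of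
  blocks by their maxima a strict linear order.
\<close>

lemma partition_on_Max_inj:
  fixes P :: "nat set set"
  assumes "finite X" "partition_on X P"
  shows "inj_on Max P"
proof (rule inj_onI)
  fix B C assume BC: "B \<in> P" "C \<in> P" "Max B = Max C"
  have *: "finite E \<and> E \<noteq> {}" if "E \<in> P" for E
    using assms that partition_onD1 partition_onD3 by (metis Union_upper finite_subset)
  have "Max B \<in> B \<inter> C" using BC * by (metis IntI Max_in)
  then show "B = C" using disjointD[OF partition_onD2[OF assms(2)] BC(1,2)] by blast
qed

lemma finite_partitions:
  assumes "finite X" shows "finite {P. partition_on X P \<and> card P = t}"
  by (rule finite_subset[OF _ finitely_many_partition_on[OF assms]]) blast

lemma partition_on_remove_block:
  assumes "partition_on X P" and "B \<in> P"
  shows "partition_on (X - B) (P - {B})"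
proof -
  have "C \<inter> B = {}" if "C \<in> P - {B}" for C
    using disjointD[OF partition_onD2[OF assms(1)] _ assms(2)] that by blast
  then have "disjnt B (\<Union> (P - {B}))" unfolding disjnt_def by blast
  moreover have "insert B (P - {B}) = P" using assms(2) by blast
  ultimately show ?thesis using partition_on_insert[of B "P - {B}" X] assms(1) by metis
qed

lemma partition_on_add_block:
  assumes "partition_on (X - B) P" "B \<subseteq> X" "B \<noteq> {}"
  shows "partition_on X (insert B P)"
proof -
  have "disjnt B (\<Union> P)" unfolding partition_onD1[OF assms(1), symmetric] disjnt_def by blast
  then show ?thesis using assms by (simp add: partition_on_insert)
qed

text \<open>
  A set partition of \<open>insert x X\<close> arises from one of \<open>X\<close> by putting \<open>x\<close> into one of the blocks or by
  adding the block \<open>{x}\<close>.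
\<close>

lemma card_partitions_insert:
  assumes X: "finite X" and x: "x \<notin> X"
  shows "card {P. partition_on (insert x X) P \<and> card P = Suc t}
    = Suc t * card {P. partition_on X P \<and> card P = Suc t} + card {P. partition_on X P \<and> card P = t}"
proof -
  let ?Q = "\<lambda>t. {P. partition_on X P \<and> card P = t}"
  let ?S = "Sigma (?Q (Suc t)) (\<lambda>P. P)"
  let ?ins = "\<lambda>(P, B). insert (insert x B) (P - {B})"
  let ?sgl = "insert {x}"
  have xP: "x \<notin> B" if "partition_on X P" "B \<in> P" for P B
    using x that partition_onD1 by blast
  have finP: "finite P" if "partition_on X P" for P using finite_elements[OF X that] .
  have "{P. partition_on (insert x X) P \<and> card P = Suc t} = ?ins ` ?S \<union> ?sgl ` ?Q t"
  proof (intro equalityI subsetI)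
    fix P assume "P \<in> {P. partition_on (insert x X) P \<and> card P = Suc t}"
    then have P: "partition_on (insert x X) P" and cP: "card P = Suc t" by auto
    have fP: "finite P" using finite_elements[OF _ P] X by simp
    have "x \<in> \<Union> P" using partition_onD1[OF P] by (metis insertI1)
    then obtain B where B: "B \<in> P" "x \<in> B" by blast
    have rest: "partition_on (X - (B - {x})) (P - {B})"
    proof -
      have "insert x X - B = X - (B - {x})" using x B(2) by auto
      then show ?thesis using partition_on_remove_block[OF P B(1)] by simp
    qed
    show "P \<in> ?ins ` ?S \<union> ?sgl ` ?Q t"
    proof (cases "B = {x}")
      case True
      have "partition_on X (P - {B})" using rest True by simp
      moreover have "card (P - {B}) = t" using cP B fP by simp
      moreover have "P = insert {x} (P - {B})" using B True by blast
      ultimately show ?thesis by blast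
    next
      case False
      let ?C = "B - {x}"
      let ?P = "insert ?C (P - {B})"
      have C: "?C \<noteq> {}" "?C \<subseteq> X"
        using False B partition_onD1[OF P] by (blast, metis Diff_subset_conv Un_insert_left Union_upper sup_bot_left)
      have CP: "?C \<notin> P - {B}"
      proof
        assume "?C \<in> P - {B}"
        then have "?C \<subseteq> X - ?C" using partition_onD1[OF rest] by blast
        then show False using C(1) by blast
      qed
      have "partition_on X ?P" by (rule partition_on_add_block[OF rest C(2,1)])
      moreover have "card ?P = Suc t" using cP B fP CP by simp
      moreover have "insert x ?C = B" "?P - {?C} = P - {B}" using B CP by blast+
      then have "P = ?ins (?P, ?C)" using B by auto
      ultimately show ?thesis by blast
    qed
  next
    fix R assume "R \<in> ?ins ` ?S \<union> ?sgl ` ?Q t"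
    then show "R \<in> {P. partition_on (insert x X) P \<and> card P = Suc t}"
    proof
      assume "R \<in> ?ins ` ?S"
      then obtain P B where P: "partition_on X P" "card P = Suc t" "B \<in> P"
        and R: "R = insert (insert x B) (P - {B})" by auto
      have "insert x X - insert x B = X - B" using x by auto
      then have "partition_on (insert x X - insert x B) (P - {B})"
        using partition_on_remove_block[OF P(1,3)] by simp
      then have "partition_on (insert x X) R"
        unfolding R by (rule partition_on_add_block) (use P partition_onD1[OF P(1)] in auto)
      moreover have "insert x B \<notin> P - {B}" using xP[OF P(1)] by blast
      then have "card R = Suc t" using P finP[OF P(1)] by (simp add: R)
      ultimately show ?thesis by simp
    next
      assume "R \<in> ?sgl ` ?Q t"
      then obtain P where P: "partition_on X P" "card P = t" and R: "R = insert {x} P" by auto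
      have "partition_on (insert x X) R"
        unfolding R by (rule partition_on_add_block) (use P x in auto)
      moreover have "{x} \<notin> P" using xP[OF P(1)] by blast
      then have "card R = Suc t" using P finP[OF P(1)] by (simp add: R)
      ultimately show ?thesis by simp
    qed
  qed
  moreover have "?ins ` ?S \<inter> ?sgl ` ?Q t = {}"
  proof -
    have "{x} \<notin> ?ins (P, B)" if "partition_on X P" "B \<in> P" for P B
    proof -
      have "x \<notin> B" "{x} \<notin> P" using xP[OF that(1)] that(2) by blast+
      moreover have "B \<noteq> {}" using that partition_onD3[OF that(1)] by blast
      ultimately have "insert x B \<noteq> {x}" by blast
      with \<open>{x} \<notin> P\<close> show ?thesis by auto
    qed
    then show ?thesis by fastforce
  qed
  moreover have "inj_on ?ins ?S"
  proof (rule inj_onI)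
    fix p q assume p: "p \<in> ?S" and q: "q \<in> ?S" and eq: "?ins p = ?ins q"
    obtain P B where pe: "p = (P, B)" by (cases p)
    obtain P' B' where qe: "q = (P', B')" by (cases q)
    have P: "partition_on X P" "B \<in> P" and P': "partition_on X P'" "B' \<in> P'"
      using p q by (auto simp: pe qe)
    have e: "insert (insert x B) (P - {B}) = insert (insert x B') (P' - {B'})"
      using eq by (simp add: pe qe)
    have "{C \<in> insert (insert x B) (P - {B}). x \<in> C} = {insert x B}"
      "{C \<in> insert (insert x B') (P' - {B'}). x \<in> C} = {insert x B'}"
      using xP[OF P(1)] xP[OF P'(1)] by auto
    with e have "insert x B = insert x B'" by simp
    then have BB: "B = B'" using xP[OF P] xP[OF P'] by (metis insert_ident)
    have "insert x B \<notin> P - {B}" "insert x B' \<notin> P' - {B'}"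
      using xP[OF P(1)] xP[OF P'(1)] by blast+
    with e BB have "P - {B} = P' - {B'}" by (metis insert_ident)
    with BB P P' have "P = P'" by blast
    with BB show "p = q" by (simp add: pe qe)
  qed
  moreover have "inj_on ?sgl (?Q t)"
  proof (rule inj_onI)
    fix P P' assume P: "P \<in> ?Q t" and P': "P' \<in> ?Q t" and e: "insert {x} P = insert {x} P'"
    have "{x} \<notin> P" "{x} \<notin> P'" using P P' xP by blast+
    with e show "P = P'" by (metis insert_ident)
  qed
  moreover have "card ?S = Suc t * card (?Q (Suc t))"
  proof -
    have "card ?S = (\<Sum>P\<in>?Q (Suc t). card P)"
      by (rule card_SigmaI) (use finite_partitions[OF X] finP in auto)
    also have "\<dots> = (\<Sum>P\<in>?Q (Suc t). Suc t)" by (rule sum.cong) auto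
    finally show ?thesis by simp
  qed
  moreover have "finite ?S" using finite_partitions[OF X] finP by (intro finite_SigmaI) auto
  moreover have "finite (?Q t)" using finite_partitions[OF X] .
  ultimately show ?thesis by (simp add: card_Un_disjoint card_image)
qed

lemma card_partitions_Stirling:
  assumes "finite X"
  shows "card {P. partition_on X P \<and> card P = t} = Stirling (card X) t"
  using assms
proof (induction X arbitrary: t rule: finite_induct)
  case empty
  have e: "{P. partition_on ({} :: 'a set) P \<and> card P = t} = (if t = 0 then {{}} else {})"
    by (auto simp: partition_on_empty)
  show ?case unfolding e by (cases t) simp_all
next
  case (insert x X)
  show ?case
  proof (cases t)
    case 0
    have e: "{P. partition_on (insert x X) P \<and> card P = 0} = {}"
    proof -
      have "P \<noteq> {}" if "partition_on (insert x X) P" for P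
        using partition_onD1[OF that] by auto
      moreover have "finite P" if "partition_on (insert x X) P" for P
        using finite_elements[OF _ that] insert.hyps(1) by simp
      ultimately show ?thesis by (auto simp: card_eq_0_iff)
    qed
    show ?thesis unfolding 0 e using insert.hyps by simp
  next
    case (Suc m)
    then show ?thesis
      using card_partitions_insert[OF insert.hyps] insert by simp
  qed
qed

section \<open>Counting increasing fillings of a skew shape\<close>

text \<open>
  The fillings of a set-partition tableau for a fixed set partition \<open>L\<close>, with \<open>key\<close> in the place of
  the maximum of a block, \<open>A\<close> in the place of the row of zeros and \<open>z\<close> in the place of the entry \<open>{0}\<close>.
  They are the standard tableaux of shape \<open>D / A\<close> with entries ordered by \<open>key\<close>. Arbitrary finite
  label sets make it possible to delete a label without renumbering the others.
\<close>

definition fillings ::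
  "('a \<Rightarrow> nat) \<Rightarrow> 'a set \<Rightarrow> 'a \<Rightarrow> (nat \<times> nat) set \<Rightarrow> (nat \<times> nat) set \<Rightarrow> (nat \<times> nat \<Rightarrow> 'a) set"
  where
  "fillings key L z A D = {T \<in> extensional D.
    (\<forall>b\<in>A. T b = z) \<and> bij_betw T (D - A) L \<and>
    (\<forall>i j j'. (i, j) \<in> D - A \<longrightarrow> (i, j') \<in> D - A \<longrightarrow> j < j' \<longrightarrow> key (T (i, j)) < key (T (i, j'))) \<and>
    (\<forall>i i' j. (i, j) \<in> D - A \<longrightarrow> (i', j) \<in> D - A \<longrightarrow> i < i' \<longrightarrow> key (T (i, j)) < key (T (i', j)))}"

text \<open>
  The greatest label has no box of \<open>D - A\<close> to its right or below it, and no box of \<open>A\<close> can be there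
  since \<open>A\<close> is itself a diagram. Hence its box is a corner of \<open>D\<close>.
\<close>

lemma fillings_remove_max:
  assumes A: "diagram A" and D: "diagram D" and T: "T \<in> fillings key L z A D"
    and l: "l \<in> L" "\<And>x. x \<in> L \<Longrightarrow> key x \<le> key l"
  obtains b T' where "b \<in> corners D - A" "T' \<in> fillings key (L - {l}) z A (D - {b})"
    "T = T'(b := l)"
proof -
  have bij: "bij_betw T (D - A) L" using T by (simp add: fillings_def)
  then obtain b where b: "b \<in> D - A" "T b = l" using l by (metis bij_betw_imp_surj_on imageE)
  obtain i j where ij: "b = (i, j)" by force
  have notA: "(x, y) \<in> D - A" if "(x, y) \<in> D" "i \<le> x" "j \<le> y" for x y
    using that b diagram_down[OF A, of x y i j] by (auto simp: ij)
  have le: "key (T c) \<le> key (T b)" if "c \<in> D - A" for c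
    using l(2) that bij b by (metis bij_betwE)
  have row: "(i, j') \<notin> D" if "j < j'" for j'
  proof
    assume "(i, j') \<in> D"
    then have "(i, j') \<in> D - A" using notA that by auto
    moreover have "key (T (i, j)) < key (T (i, j'))"
      using T b that calculation by (auto simp: fillings_def ij)
    ultimately show False using le[of "(i, j')"] by (simp add: ij)
  qed
  have col: "(i', j) \<notin> D" if "i < i'" for i'
  proof
    assume "(i', j) \<in> D"
    then have "(i', j) \<in> D - A" using notA that by auto
    moreover have "key (T (i, j)) < key (T (i', j))"
      using T b that calculation by (auto simp: fillings_def ij)
    ultimately show False using le[of "(i', j)"] by (simp add: ij)
  qed
  have "diagram (D - {b})"
    unfolding diagram_def
  proof (intro conjI allI impI)
    fix x y x' y' assume xy: "(x, y) \<in> D - {b}" "x' \<le> x" "y' \<le> y"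
    have "(x', y') \<noteq> (i, j)"
    proof
      assume e: "(x', y') = (i, j)"
      then have "(x, j) \<in> D" "(i, y) \<in> D" using xy diagram_down[OF D, of x y] by auto
      then have "\<not> i < x" "\<not> j < y" using row col by blast+
      then show False using xy e by (auto simp: ij)
    qed
    then show "(x', y') \<in> D - {b}" using xy diagram_down[OF D] by (auto simp: ij)
  qed (use diagram_finite[OF D] in simp)
  then have "b \<in> corners D - A" using b by (simp add: corners_def)
  moreover have "bij_betw T (D - {b} - A) (L - {l})"
  proof -
    have "D - {b} - A = (D - A) - {b}" by blast
    moreover have "bij_betw T ((D - A) - {b}) (L - {T b})"
      using bij b by (auto simp: bij_betw_def inj_on_def)
    ultimately show ?thesis using b by simp
  qed
  then have "bij_betw (T(b := undefined)) (D - {b} - A) (L - {l})"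
    by (subst bij_betw_cong[where g = T]) auto
  then have "T(b := undefined) \<in> fillings key (L - {l}) z A (D - {b})"
    using T b by (auto simp: fillings_def extensional_def)
  moreover have "T = (T(b := undefined))(b := l)" using b by auto
  ultimately show thesis by (rule that)
qed

lemma fillings_add_max:
  assumes D: "diagram D" and b: "b \<in> corners D - A"
    and T: "T \<in> fillings key (L - {l}) z A (D - {b})"
    and l: "l \<in> L" and max: "\<And>x. x \<in> L - {l} \<Longrightarrow> key x < key l"
  shows "T(b := l) \<in> fillings key L z A D"
proof -
  have bij: "bij_betw T (D - {b} - A) (L - {l})" using T by (simp add: fillings_def)
  have bD: "b \<in> D - A" and dia: "diagram (D - {b})" using b by (auto simp: corners_def)
  have lt: "key (T c) < key l" if "c \<in> D - A" "c \<noteq> b" for c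
    using bij_betwE[OF bij] that max by blast
  have "bij_betw (T(b := l)) (D - {b} - A) (L - {l})"
    using bij by (subst bij_betw_cong[where g = T]) auto
  moreover have "bij_betw (T(b := l)) {b} {l}" by simp
  ultimately have "bij_betw (T(b := l)) ((D - {b} - A) \<union> {b}) ((L - {l}) \<union> {l})"
    by (rule bij_betw_combine) simp
  moreover have "(D - {b} - A) \<union> {b} = D - A" "(L - {l}) \<union> {l} = L" using bD l by auto
  ultimately have "bij_betw (T(b := l)) (D - A) L" by simp
  moreover have "key ((T(b := l)) (i, j)) < key ((T(b := l)) (i, j'))"
    if ij: "(i, j) \<in> D - A" "(i, j') \<in> D - A" "j < j'" for i j j'
  proof -
    have nb: "(i, j) \<noteq> b" using diagram_down[OF dia, of i j' i j] ij by auto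
    show ?thesis
    proof (cases "(i, j') = b")
      case True
      then show ?thesis using nb lt[OF ij(1)] by auto
    next
      case False
      then show ?thesis using nb T ij by (auto simp: fillings_def)
    qed
  qed
  moreover have "key ((T(b := l)) (i, j)) < key ((T(b := l)) (i', j))"
    if ij: "(i, j) \<in> D - A" "(i', j) \<in> D - A" "i < i'" for i i' j
  proof -
    have nb: "(i, j) \<noteq> b" using diagram_down[OF dia, of i' j i j] ij by auto
    show ?thesis
    proof (cases "(i', j) = b")
      case True
      then show ?thesis using nb lt[OF ij(1)] by auto
    next
      case False
      then show ?thesis using nb T ij by (auto simp: fillings_def)
    qed
  qed
  moreover have "T(b := l) \<in> extensional D" "\<forall>c\<in>A. (T(b := l)) c = z"
    using T bD by (auto simp: fillings_def extensional_def)
  ultimately show ?thesis unfolding fillings_def by blast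
qed

lemma up_pow_delta_not_subset:
  "\<not> A \<subseteq> D \<Longrightarrow> (up ^^ t) (delta A) D = 0"
proof (induction t arbitrary: D)
  case (Suc t)
  then have "(up ^^ t) (delta A) (D - {b}) = 0" for b by blast
  then show ?case by (simp add: up_def[of "(up ^^ t) (delta A)"])
qed auto

text \<open>
  Deleting the boxes in decreasing order of their labels turns a filling into a chain of diagrams
  from \<open>D\<close> down to \<open>A\<close>, and such chains are what iterating \<open>up\<close> on \<open>delta A\<close> counts.
\<close>

lemma card_fillings:
  assumes A: "diagram A" and "diagram D" "A \<subseteq> D" "finite L" "inj_on key L" "card L = t"
  shows "finite (fillings key L z A D) \<and> card (fillings key L z A D) = (up ^^ t) (delta A) D"
  using assms(2-)
proof (induction t arbitrary: D L)
  case 0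
  then have L: "L = {}" by simp
  show ?case
  proof (cases "D = A")
    case True
    have "fillings key L z A D = {\<lambda>b. if b \<in> D then z else undefined}"
      by (auto simp: fillings_def L True extensional_def bij_betw_def)
    then show ?thesis using True by simp
  next
    case False
    then have "fillings key L z A D = {}"
      using \<open>A \<subseteq> D\<close> by (auto simp: fillings_def L bij_betw_def)
    then show ?thesis using False by simp
  qed
next
  case (Suc t)
  have "L \<noteq> {}" using Suc.prems by auto
  obtain l where l: "l \<in> L" and le: "\<And>x. x \<in> L \<Longrightarrow> key x \<le> key l"
  proof -
    have "Max (key ` L) \<in> key ` L" using \<open>L \<noteq> {}\<close> \<open>finite L\<close> by simp
    then obtain l where "l \<in> L" "Max (key ` L) = key l" by blast
    moreover have "key x \<le> Max (key ` L)" if "x \<in> L" for x using that \<open>finite L\<close> by simp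
    ultimately show thesis using that by simp
  qed
  have max: "key x < key l" if "x \<in> L - {l}" for x
    using that le[of x] inj_onD[OF \<open>inj_on key L\<close>, of x l] l by fastforce
  have D: "diagram D" by fact
  let ?F = "\<lambda>b. fillings key (L - {l}) z A (D - {b})"
  let ?C = "corners D - A"
  have IH: "finite (?F b) \<and> card (?F b) = (up ^^ t) (delta A) (D - {b})" if "b \<in> ?C" for b
    by (rule Suc.IH) (use that Suc.prems l in \<open>auto simp: corners_def inj_on_diff\<close>)
  have eq: "fillings key L z A D = (\<lambda>(b, T). T(b := l)) ` (Sigma ?C ?F)"
  proof (intro equalityI subsetI)
    fix T assume "T \<in> fillings key L z A D"
    then obtain b S where "b \<in> ?C" "S \<in> ?F b" "T = S(b := l)"
      by (rule fillings_remove_max[where key = key and L = L and l = l, OF A D _ l le])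
    then show "T \<in> (\<lambda>(b, T). T(b := l)) ` (Sigma ?C ?F)"
      by (intro image_eqI[where x = "(b, S)"]) auto
  next
    fix T assume "T \<in> (\<lambda>(b, T). T(b := l)) ` (Sigma ?C ?F)"
    then obtain b S where S: "b \<in> ?C" "S \<in> ?F b" "T = S(b := l)" by auto
    show "T \<in> fillings key L z A D"
      unfolding S(3) by (rule fillings_add_max[where key = key and L = L and l = l, OF D S(1,2) l max])
  qed
  have inj: "inj_on (\<lambda>(b, T). T(b := l)) (Sigma ?C ?F)"
  proof (rule inj_onI)
    fix p q assume p: "p \<in> Sigma ?C ?F" and q: "q \<in> Sigma ?C ?F"
      and e: "(\<lambda>(b, T). T(b := l)) p = (\<lambda>(b, T). T(b := l)) q"
    obtain b T where pe: "p = (b, T)" by (cases p)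
    obtain c S where qe: "q = (c, S)" by (cases q)
    have F: "b \<in> ?C" "T \<in> ?F b" "c \<in> ?C" "S \<in> ?F c" using p q by (auto simp: pe qe)
    then have T: "b \<in> D - A" "T b = undefined" and S: "c \<in> D - A" "S c = undefined"
      by (auto simp: corners_def fillings_def intro: extensional_arb)
    have bij: "bij_betw T (D - {b} - A) (L - {l})" using F(2) by (simp add: fillings_def)
    have e': "T(b := l) = S(c := l)" using e by (simp add: pe qe)
    have bc: "b = c"
    proof (rule ccontr)
      assume "b \<noteq> c"
      then have "T c = l" using fun_cong[OF e', of c] by simp
      with bij_betwE[OF bij] S \<open>b \<noteq> c\<close> show False by blast
    qed
    have "T = S"
    proof
      fix x
      show "T x = S x"
        using fun_cong[OF e', of x] T(2) S(2) by (cases "x = c") (simp_all add: bc)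
    qed
    with bc show "p = q" by (simp add: pe qe)
  qed
  have finC: "finite ?C" using finite_corners[OF D] by simp
  have "card (fillings key L z A D) = (\<Sum>b\<in>?C. card (?F b))"
    unfolding eq card_image[OF inj] by (rule card_SigmaI) (use finC IH in auto)
  also have "\<dots> = (\<Sum>b\<in>?C. (up ^^ t) (delta A) (D - {b}))" using IH by simp
  \<comment> \<open>Removing a corner inside \<open>A\<close> leaves a diagram that cannot be reached from \<open>A\<close>.\<close>
  also have "\<dots> = (\<Sum>b\<in>corners D. (up ^^ t) (delta A) (D - {b}))"
    by (rule sum.mono_neutral_left)
      (use finite_corners[OF D] in \<open>auto intro!: up_pow_delta_not_subset\<close>)
  also have "\<dots> = (up ^^ Suc t) (delta A) D" by (simp add: up_def)
  finally have "card (fillings key L z A D) = (up ^^ Suc t) (delta A) D" .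
  moreover have "finite (fillings key L z A D)"
    unfolding eq by (intro finite_imageI finite_SigmaI) (use finC IH in auto)
  ultimately show ?case by simp
qed

section \<open>Partitions as diagrams\<close>

lemma young_diagram_one_part: "young_diagram (one_part m) = row m"
  by (auto simp: young_diagram_def one_part_def row_def)

lemma one_part_partition: "one_part n \<in> partitions_of n"
  by (simp add: one_part_def partitions_of_def)

lemma card_young_diagram: "card (young_diagram lam) = sum_list lam"
proof -
  have "young_diagram lam = Sigma {..<length lam} (\<lambda>i. {..<lam ! i})"
    by (auto simp: young_diagram_def)
  then show ?thesis by (simp add: sum_list_sum_nth atLeast0LessThan)
qed

lemma diagram_young_diagram:
  assumes "lam \<in> partitions_of n"
  shows "diagram (young_diagram lam)"
  unfolding diagram_def
proof (intro conjI allI impI)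
  have "young_diagram lam = Sigma {..<length lam} (\<lambda>i. {..<lam ! i})"
    by (auto simp: young_diagram_def)
  then show "finite (young_diagram lam)" by simp
next
  fix i j i' j' assume h: "(i, j) \<in> young_diagram lam" "i' \<le> i" "j' \<le> j"
  have "lam ! i \<le> lam ! i'"
    using assms h sorted_wrt_nth_less[of "(\<ge>)" lam i' i]
    by (cases "i' = i") (auto simp: partitions_of_def young_diagram_def)
  then show "(i', j') \<in> young_diagram lam" using h by (auto simp: young_diagram_def)
qed

lemma bij_betw_young_diagram:
  "bij_betw young_diagram (partitions_of n) {D. diagram D \<and> card D = n}"
proof (rule bij_betw_imageI)
  show "inj_on young_diagram (partitions_of n)"
  proof (rule inj_onI)
    fix lam \<mu> assume lam: "lam \<in> partitions_of n" and mu: "\<mu> \<in> partitions_of n"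
      and eq: "young_diagram lam = young_diagram \<mu>"
    have len: "{i. (i, 0) \<in> young_diagram x} = {..<length x}" if "x \<in> partitions_of n" for x
      using that by (auto simp: young_diagram_def partitions_of_def in_set_conv_nth)
    have nth: "{j. (i, j) \<in> young_diagram x} = {..<x ! i}" if "i < length x" for x i
      using that by (auto simp: young_diagram_def)
    have "{..<length lam} = {..<length \<mu>}" using len[OF lam] len[OF mu] eq by simp
    then have l: "length lam = length \<mu>" by simp
    show "lam = \<mu>"
    proof (rule nth_equalityI[OF l])
      fix i assume "i < length lam"
      then have "{..<lam ! i} = {..<\<mu> ! i}" using nth[of i lam] nth[of i \<mu>] eq l by simp
      then show "lam ! i = \<mu> ! i" by simp
    qed
  qed
  show "young_diagram ` partitions_of n = {D. diagram D \<and> card D = n}"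
  proof (intro equalityI subsetI)
    fix D assume "D \<in> young_diagram ` partitions_of n"
    then show "D \<in> {D. diagram D \<and> card D = n}"
      by (auto simp: card_young_diagram intro: diagram_young_diagram) (simp add: partitions_of_def)
  next
    fix D assume "D \<in> {D. diagram D \<and> card D = n}"
    then have D: "diagram D" and n: "card D = n" by auto
    obtain r where r: "antimono r" and Dr: "D = {(i, j). j < r i}" using diagram_row_lengths[OF D] .
    let ?R = "{i. 0 < r i}"
    have "finite ?R"
      by (rule finite_subset[of _ "fst ` D"]) (use diagram_finite[OF D] in \<open>force simp: Dr\<close>)+
    then have R: "?R = {..<card ?R}"
      by (rule finite_down_set_eq_lessThan) (use antimonoD[OF r] in \<open>force dest: less_le_trans\<close>)
    let ?lam = "map r [0..<card ?R]"
    have pos: "0 < r i \<longleftrightarrow> i < card ?R" for i using R by blast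
    have yd: "young_diagram ?lam = D"
    proof (rule set_eqI)
      fix b
      show "b \<in> young_diagram ?lam \<longleftrightarrow> b \<in> D"
        using pos[of "fst b"] by (cases b) (auto simp: young_diagram_def Dr)
    qed
    moreover have "?lam \<in> partitions_of n"
      unfolding partitions_of_def
    proof (intro CollectI conjI)
      show "sorted_wrt (\<ge>) ?lam"
        by (auto simp: sorted_wrt_iff_nth_less intro!: antimonoD[OF r])
      show "0 \<notin> set ?lam" using pos by (metis (no_types, lifting) atLeastLessThan_iff imageE list.set_map less_irrefl set_upt)
      show "sum_list ?lam = n" using card_young_diagram[of ?lam] yd n by simp
    qed
    ultimately show "D \<in> young_diagram ` partitions_of n" by (metis imageI)
  qed
qed

lemmas inj_young_diagram = bij_betw_imp_inj_on[OF bij_betw_young_diagram]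

lemma partition_of_diagram:
  assumes "diagram D" "card D = n"
  obtains lam where "lam \<in> partitions_of n" "young_diagram lam = D"
  using assms bij_betw_imp_surj_on[OF bij_betw_young_diagram, of n] by (metis (mono_tags, lifting) imageE mem_Collect_eq)

lemma partition_facts:
  assumes "lam \<in> partitions_of n"
  shows "diagram (young_diagram lam)" "card (young_diagram lam) = n"
  using bij_betwE[OF bij_betw_young_diagram] assms by blast+

section \<open>Counting vacillating tableaux\<close>

definition lower :: "nat \<Rightarrow> nat list \<Rightarrow> nat list set" where
  "lower n lam = {\<mu> \<in> partitions_of (n - 1). add_box \<mu> lam}"
definition upper :: "nat \<Rightarrow> nat list \<Rightarrow> nat list set" where
  "upper n \<mu> = {\<nu> \<in> partitions_of n. remove_box \<nu> \<mu>}"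

text \<open>
  Partitions correspond to diagrams, and the removal or addition of a box to corners and outer
  corners. So the operators can be written as sums over the partitions that are one step away.
\<close>

lemma sum_lower:
  assumes lam: "lam \<in> partitions_of n" and "n \<ge> 1"
  shows "finite (lower n lam)"
    and "(\<Sum>\<mu>\<in>lower n lam. g (young_diagram \<mu>)) = up g (young_diagram lam)"
proof -
  let ?D = "young_diagram lam"
  have D: "diagram ?D" "card ?D = n" using partition_facts[OF lam] .
  have fin: "finite ?D" using diagram_finite[OF D(1)] .
  have img: "young_diagram ` lower n lam = (\<lambda>b. ?D - {b}) ` corners ?D"
  proof (intro equalityI subsetI)
    fix E assume "E \<in> young_diagram ` lower n lam"
    then obtain \<mu> b where mu: "\<mu> \<in> partitions_of (n - 1)" "E = young_diagram \<mu>"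
      and b: "b \<notin> young_diagram \<mu>" "?D = insert b (young_diagram \<mu>)"
      by (auto simp: lower_def add_box_def)
    have "E = ?D - {b}" using b mu by auto
    moreover have "b \<in> corners ?D" unfolding corners_def
      using partition_facts(1)[OF mu(1)] mu(2) b calculation by auto
    ultimately show "E \<in> (\<lambda>b. ?D - {b}) ` corners ?D" by blast
  next
    fix E assume "E \<in> (\<lambda>b. ?D - {b}) ` corners ?D"
    then obtain b where b: "b \<in> ?D" "diagram (?D - {b})" "E = ?D - {b}" by (auto simp: corners_def)
    have "card (?D - {b}) = n - 1" using b(1) D(2) fin by simp
    then obtain \<mu> where mu: "\<mu> \<in> partitions_of (n - 1)" "young_diagram \<mu> = ?D - {b}"
      using partition_of_diagram[OF b(2)] by blast
    have "add_box \<mu> lam" unfolding add_box_def mu(2) using b(1) by (intro exI[of _ b]) auto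
    with mu b show "E \<in> young_diagram ` lower n lam" by (auto simp: lower_def)
  qed
  have inj: "inj_on young_diagram (lower n lam)"
    by (rule inj_on_subset[OF inj_young_diagram]) (auto simp: lower_def)
  have inj': "inj_on (\<lambda>b. ?D - {b}) (corners ?D)"
    by (rule inj_onI) (auto simp: corners_def)
  show "finite (lower n lam)"
    using img finite_imageD[OF _ inj] finite_corners[OF D(1)] by simp
  have "(\<Sum>\<mu>\<in>lower n lam. g (young_diagram \<mu>)) = sum g (young_diagram ` lower n lam)"
    by (simp add: sum.reindex[OF inj])
  also have "\<dots> = up g ?D" unfolding img up_def by (simp add: sum.reindex[OF inj'])
  finally show "(\<Sum>\<mu>\<in>lower n lam. g (young_diagram \<mu>)) = up g ?D" .
qed

lemma sum_upper:
  assumes mu: "\<mu> \<in> partitions_of (n - 1)" and n: "n \<ge> 1"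
  shows "finite (upper n \<mu>)"
    and "(\<Sum>\<nu>\<in>upper n \<mu>. g (young_diagram \<nu>)) = down g (young_diagram \<mu>)"
proof -
  let ?D = "young_diagram \<mu>"
  have D: "diagram ?D" "card ?D = n - 1" using partition_facts[OF mu] .
  have fin: "finite ?D" using diagram_finite[OF D(1)] .
  have img: "young_diagram ` upper n \<mu> = (\<lambda>b. insert b ?D) ` outer_corners ?D"
  proof (intro equalityI subsetI)
    fix E assume "E \<in> young_diagram ` upper n \<mu>"
    then obtain \<nu> b where nu: "\<nu> \<in> partitions_of n" "E = young_diagram \<nu>"
      and b: "b \<in> young_diagram \<nu>" "?D = young_diagram \<nu> - {b}"
      by (auto simp: upper_def remove_box_def)
    have "E = insert b ?D" using b nu by auto
    moreover have "b \<in> outer_corners ?D" unfolding outer_corners_def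
      using partition_facts(1)[OF nu(1)] nu(2) b calculation by auto
    ultimately show "E \<in> (\<lambda>b. insert b ?D) ` outer_corners ?D" by blast
  next
    fix E assume "E \<in> (\<lambda>b. insert b ?D) ` outer_corners ?D"
    then obtain b where b: "b \<notin> ?D" "diagram (insert b ?D)" "E = insert b ?D"
      by (auto simp: outer_corners_def)
    have "card (insert b ?D) = n" using b(1) D(2) fin n by simp
    then obtain \<nu> where nu: "\<nu> \<in> partitions_of n" "young_diagram \<nu> = insert b ?D"
      using partition_of_diagram[OF b(2)] by blast
    have "remove_box \<nu> \<mu>" unfolding remove_box_def nu(2) using b(1) by (intro bexI[of _ b]) auto
    with nu b show "E \<in> young_diagram ` upper n \<mu>" by (auto simp: upper_def)
  qed
  have inj: "inj_on young_diagram (upper n \<mu>)"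
    by (rule inj_on_subset[OF inj_young_diagram]) (auto simp: upper_def)
  have inj': "inj_on (\<lambda>b. insert b ?D) (outer_corners ?D)"
    by (rule inj_onI) (auto simp: outer_corners_def)
  show "finite (upper n \<mu>)"
    using img finite_imageD[OF _ inj] card_outer_corners(1)[OF D(1)] by simp
  have "(\<Sum>\<nu>\<in>upper n \<mu>. g (young_diagram \<nu>)) = sum g (young_diagram ` upper n \<mu>)"
    by (simp add: sum.reindex[OF inj])
  also have "\<dots> = down g ?D" unfolding img down_def by (simp add: sum.reindex[OF inj'])
  finally show "(\<Sum>\<nu>\<in>upper n \<mu>. g (young_diagram \<nu>)) = down g ?D" .
qed

lemma vacillating_tableaux_Suc:
  assumes lam: "lam \<in> partitions_of n"
  shows "vacillating_tableaux n (Suc k) lam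
    = (\<lambda>(\<mu>, \<nu>, v). v @ [\<mu>, lam]) `
      (SIGMA \<mu>:lower n lam. SIGMA \<nu>:upper n \<mu>. vacillating_tableaux n k \<nu>)"
proof (intro equalityI subsetI)
  fix v assume v: "v \<in> vacillating_tableaux n (Suc k) lam"
  let ?w = "take (2 * k + 1) v" and ?mu = "v ! (2 * k + 1)" and ?nu = "v ! (2 * k)"
  have len: "length v = 2 * k + 3" and last: "v ! (2 * k + 2) = lam"
    and at: "\<And>i. i \<le> Suc k \<Longrightarrow> v ! (2 * i) \<in> partitions_of n"
    and st: "\<And>i. i < Suc k \<Longrightarrow> v ! (2 * i + 1) \<in> partitions_of (n - 1) \<and>
        remove_box (v ! (2 * i)) (v ! (2 * i + 1)) \<and> add_box (v ! (2 * i + 1)) (v ! (2 * i + 2))"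
    using v by (auto simp: vacillating_tableaux_def)
  have "drop (2 * k + 1) v = ?mu # v ! (2 * k + 2) # drop (2 * k + 3) v"
    using Cons_nth_drop_Suc[of "2 * k + 1" v] Cons_nth_drop_Suc[of "2 * k + 2" v] len
    by (simp add: eval_nat_numeral)
  then have tail: "drop (2 * k + 1) v = [?mu, lam]" unfolding last by (simp add: len)
  have "v = ?w @ [?mu, lam]" using append_take_drop_id[of "2 * k + 1" v, symmetric] unfolding tail .
  moreover have "?mu \<in> lower n lam" using st[of k] last by (simp add: lower_def)
  moreover have "?nu \<in> upper n ?mu" using st[of k] at[of k] by (simp add: upper_def)
  moreover have "?w \<in> vacillating_tableaux n k ?nu"
    using v by (auto simp: vacillating_tableaux_def)
  ultimately show "v \<in> (\<lambda>(\<mu>, \<nu>, v). v @ [\<mu>, lam]) `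
      (SIGMA \<mu>:lower n lam. SIGMA \<nu>:upper n \<mu>. vacillating_tableaux n k \<nu>)"
    by (intro image_eqI[where x = "(?mu, ?nu, ?w)"]) simp_all
next
  fix v assume "v \<in> (\<lambda>(\<mu>, \<nu>, v). v @ [\<mu>, lam]) `
      (SIGMA \<mu>:lower n lam. SIGMA \<nu>:upper n \<mu>. vacillating_tableaux n k \<nu>)"
  then obtain \<mu> \<nu> w where v: "v = w @ [\<mu>, lam]" and mu: "\<mu> \<in> lower n lam"
    and nu: "\<nu> \<in> upper n \<mu>" and w: "w \<in> vacillating_tableaux n k \<nu>" by auto
  have len: "length w = 2 * k + 1" and last: "w ! (2 * k) = \<nu>" and first: "w ! 0 = one_part n"
    using w by (auto simp: vacillating_tableaux_def)
  have old: "v ! i = w ! i" if "i \<le> 2 * k" for i using that by (simp add: v len nth_append)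
  have new: "v ! (2 * k + 1) = \<mu>" "v ! (2 * k + 2) = lam" by (simp_all add: v len nth_append)
  show "v \<in> vacillating_tableaux n (Suc k) lam"
    unfolding vacillating_tableaux_def
  proof (intro CollectI conjI allI impI)
    show "length v = 2 * Suc k + 1" by (simp add: v len)
    show "v ! 0 = one_part n" using old[of 0] first by simp
    show "v ! (2 * Suc k) = lam" using new by simp
    show "v ! (2 * i) \<in> partitions_of n" if "i \<le> Suc k" for i
    proof (cases "i = Suc k")
      case True
      then show ?thesis using new lam by simp
    next
      case False
      then show ?thesis using that w old[of "2 * i"] by (simp add: vacillating_tableaux_def)
    qed
    fix i assume i: "i < Suc k"
    have *: "v ! (2 * i + 1) \<in> partitions_of (n - 1) \<and>
        remove_box (v ! (2 * i)) (v ! (2 * i + 1)) \<and> add_box (v ! (2 * i + 1)) (v ! (2 * i + 2))"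
    proof (cases "i = k")
      case True
      then show ?thesis using new old[of "2 * k"] last mu nu by (simp add: lower_def upper_def)
    next
      case False
      then have "i < k" using i by simp
      then show ?thesis
        using w old[of "2 * i"] old[of "2 * i + 1"] old[of "2 * i + 2"]
        by (simp add: vacillating_tableaux_def)
    qed
    then show "v ! (2 * i + 1) \<in> partitions_of (n - 1)"
      "remove_box (v ! (2 * i)) (v ! (2 * i + 1))" "add_box (v ! (2 * i + 1)) (v ! (2 * i + 2))"
      by blast+
  qed
qed

text \<open>
  The last two steps of a vacillating tableau, read backwards from its shape, remove a box and add
  a box, so one more step applies \<open>up \<circ> down\<close> to the function that counts the tableaux by shape.
\<close>

lemma card_vacillating_tableaux:
  assumes "n \<ge> 1" and "lam \<in> partitions_of n"
  shows "finite (vacillating_tableaux n k lam) \<and> card (vacillating_tableaux n k lam)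
    = ((\<lambda>g. up (down g)) ^^ k) (delta (row n)) (young_diagram lam)"
  using assms(2)
proof (induction k arbitrary: lam)
  case 0
  have iff: "young_diagram lam = row n \<longleftrightarrow> lam = one_part n"
    using inj_onD[OF inj_young_diagram _ 0 one_part_partition] by (auto simp: young_diagram_one_part)
  have "vacillating_tableaux n 0 lam = (if lam = one_part n then {[lam]} else {})"
    using 0 by (auto simp: vacillating_tableaux_def length_Suc_conv)
  then show ?case by (simp add: iff)
next
  case (Suc k)
  let ?w = "((\<lambda>g. up (down g)) ^^ k) (delta (row n))"
  let ?V = "vacillating_tableaux n k"
  let ?S = "SIGMA \<mu>:lower n lam. SIGMA \<nu>:upper n \<mu>. ?V \<nu>"
  have V: "finite (?V \<nu>) \<and> card (?V \<nu>) = ?w (young_diagram \<nu>)" if "\<nu> \<in> upper n \<mu>" for \<mu> \<nu>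
    using that Suc.IH by (simp add: upper_def)
  have mu: "\<mu> \<in> partitions_of (n - 1)" if "\<mu> \<in> lower n lam" for \<mu>
    using that by (simp add: lower_def)
  note finU = sum_upper(1)[OF mu assms(1)]
  have inner: "finite (SIGMA \<nu>:upper n \<mu>. ?V \<nu>) \<and>
      card (SIGMA \<nu>:upper n \<mu>. ?V \<nu>) = down ?w (young_diagram \<mu>)"
    if "\<mu> \<in> lower n lam" for \<mu>
  proof
    show "finite (SIGMA \<nu>:upper n \<mu>. ?V \<nu>)" using finU[OF that] V by (intro finite_SigmaI) auto
    have "card (SIGMA \<nu>:upper n \<mu>. ?V \<nu>) = (\<Sum>\<nu>\<in>upper n \<mu>. card (?V \<nu>))"
      by (rule card_SigmaI) (use finU[OF that] V in auto)
    also have "\<dots> = (\<Sum>\<nu>\<in>upper n \<mu>. ?w (young_diagram \<nu>))" by (intro sum.cong refl) (use V in blast)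
    also have "\<dots> = down ?w (young_diagram \<mu>)" by (rule sum_upper(2)[OF mu[OF that] assms(1)])
    finally show "card (SIGMA \<nu>:upper n \<mu>. ?V \<nu>) = down ?w (young_diagram \<mu>)" .
  qed
  note finL = sum_lower(1)[OF Suc.prems assms(1)]
  have inj: "inj_on (\<lambda>(\<mu>, \<nu>, v). v @ [\<mu>, lam]) ?S"
  proof -
    have V: "\<nu> = v ! (2 * k)" "length v = 2 * k + 1" if "v \<in> ?V \<nu>" for v \<nu>
      using that by (simp_all add: vacillating_tableaux_def)
    show ?thesis
    proof (rule inj_onI)
      fix p q
      assume p: "p \<in> ?S" and q: "q \<in> ?S"
        and eq: "(\<lambda>(\<mu>, \<nu>, v). v @ [\<mu>, lam]) p = (\<lambda>(\<mu>, \<nu>, v). v @ [\<mu>, lam]) q"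
      obtain \<mu> \<nu> v where pe: "p = (\<mu>, \<nu>, v)" by (cases p)
      obtain \<mu>' \<nu>' v' where qe: "q = (\<mu>', \<nu>', v')" by (cases q)
      have v: "v \<in> ?V \<nu>" "v' \<in> ?V \<nu>'" "v @ [\<mu>, lam] = v' @ [\<mu>', lam]"
        using p q eq by (simp_all add: pe qe)
      show "p = q" using V[OF v(1)] V[OF v(2)] v(3) by (simp add: pe qe)
    qed
  qed
  have finS: "finite ?S" by (rule finite_SigmaI[OF finL]) (use inner in blast)
  have "card ?S = (\<Sum>\<mu>\<in>lower n lam. card (SIGMA \<nu>:upper n \<mu>. ?V \<nu>))"
    by (rule card_SigmaI) (use finL inner in auto)
  also have "\<dots> = (\<Sum>\<mu>\<in>lower n lam. down ?w (young_diagram \<mu>))"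
    by (intro sum.cong refl) (use inner in blast)
  also have "\<dots> = up (down ?w) (young_diagram lam)"
    by (rule sum_lower(2)[OF Suc.prems assms(1)])
  finally show ?case
    unfolding vacillating_tableaux_Suc[OF Suc.prems] card_image[OF inj] using finS by simp
qed

section \<open>Counting set-partition tableaux\<close>

lemma set_partition_tableaux_eq:
  "set_partition_tableaux n k t lam = (\<Union>P\<in>{P. partition_on {1..k} P \<and> card P = t}.
    fillings Max P {0} (row (n - t)) (young_diagram lam))"
  unfolding set_partition_tableaux_def fillings_def young_diagram_one_part Let_def by blast

lemma card_set_partition_tableaux:
  assumes lam: "lam \<in> partitions_of n" and t: "sum_list (sharp lam) \<le> t"
  shows "finite (set_partition_tableaux n k t lam) \<and> card (set_partition_tableaux n k t lam)
    = Stirling k t * (up ^^ t) (delta (row (n - t))) (young_diagram lam)"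
proof -
  let ?Q = "{P. partition_on {1..k} P \<and> card P = t}"
  let ?F = "\<lambda>P. fillings Max P {0} (row (n - t)) (young_diagram lam)"
  have finQ: "finite ?Q" using finite_partitions[of "{1..k}"] by simp
  have sub: "row (n - t) \<subseteq> young_diagram lam"
    using lam t by (cases lam) (auto simp: row_def young_diagram_def sharp_def partitions_of_def)
  have F: "finite (?F P) \<and> card (?F P) = (up ^^ t) (delta (row (n - t))) (young_diagram lam)"
    if "P \<in> ?Q" for P
    using that finite_elements[of "{1..k}" P] partition_on_Max_inj[of "{1..k}" P]
    by (intro card_fillings diagram_row partition_facts(1)[OF lam] sub) auto
  have disj: "?F P \<inter> ?F Q = {}" if "P \<noteq> Q" for P Q
    using that by (auto simp: fillings_def bij_betw_def)
  have "card (\<Union>P\<in>?Q. ?F P) = (\<Sum>P\<in>?Q. card (?F P))"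
    by (rule card_UN_disjoint) (use finQ F disj in auto)
  also have "\<dots> = (\<Sum>P\<in>?Q. (up ^^ t) (delta (row (n - t))) (young_diagram lam))"
    by (intro sum.cong refl) (use F in blast)
  also have "\<dots> = Stirling k t * (up ^^ t) (delta (row (n - t))) (young_diagram lam)"
    using card_partitions_Stirling[of "{1..k}" t] by simp
  finally show ?thesis unfolding set_partition_tableaux_eq using finQ F by auto
qed

text \<open>
  The entry \<open>{0}\<close> is never a block of a set partition of \<open>{1..k}\<close>. Hence a set-partition tableau
  determines its number \<open>t\<close> of blocks, and the union over \<open>t\<close> is disjoint.
\<close>

lemma zero_boxes:
  assumes "T \<in> set_partition_tableaux n k t lam" and "row (n - t) \<subseteq> young_diagram lam"
  shows "{b \<in> young_diagram lam. T b = {0}} = row (n - t)"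
proof -
  obtain P where P: "partition_on {1..k} P" and T: "T \<in> fillings Max P {0} (row (n - t)) (young_diagram lam)"
    using assms(1) by (auto simp: set_partition_tableaux_eq)
  have "{0} \<notin> P"
  proof
    assume "{0} \<in> P"
    then have "0 \<in> \<Union> P" by blast
    then show False unfolding partition_onD1[OF P, symmetric] by simp
  qed
  moreover have "bij_betw T (young_diagram lam - row (n - t)) P" using T by (simp add: fillings_def)
  ultimately have "T b \<noteq> {0}" if "b \<in> young_diagram lam - row (n - t)" for b
    using that bij_betwE by metis
  moreover have "T b = {0}" if "b \<in> row (n - t)" for b using T that by (simp add: fillings_def)
  ultimately show ?thesis using assms(2) by blast
qed

lemma card_row: "card (row m) = m"
  by (simp add: row_def)

theorem theorem3p19:
  fixes k n :: nat and lam :: "nat list"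
  assumes "n \<ge> 1"
    and "lam \<in> Lambda_Sn TYPE('f::field_char_0) k n"
  shows "\<exists>f. bij_betw f (vacillating_tableaux n k lam)
    (\<Union>t\<in>{sum_list (sharp lam)..n}. set_partition_tableaux n k t lam)"
proof -
  have lam: "lam \<in> partitions_of n" using assms(2) by (simp add: Lambda_Sn_def)
  let ?D = "young_diagram lam" and ?s = "sum_list (sharp lam)"
  let ?V = "vacillating_tableaux n k lam"
  let ?X = "\<lambda>t. Stirling k t * (up ^^ t) (delta (row (n - t))) ?D"
  let ?T = "\<lambda>t. set_partition_tableaux n k t lam"
  have sub: "row (n - t) \<subseteq> ?D \<longleftrightarrow> ?s \<le> t" if "t \<le> n" for t
  proof (cases lam)
    case Nil
    then show ?thesis using lam assms(1) by (simp add: partitions_of_def)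
  next
    case (Cons a ms)
    then have "n = a + ?s" using lam by (simp add: partitions_of_def sharp_def)
    moreover have "row (n - t) \<subseteq> ?D \<longleftrightarrow> n - t \<le> a"
    proof
      assume "row (n - t) \<subseteq> ?D"
      then have "n - t > 0 \<Longrightarrow> (0, n - t - 1) \<in> ?D" by (rule subsetD) simp
      then show "n - t \<le> a" by (cases "t < n") (auto simp: young_diagram_def Cons)
    qed (auto simp: young_diagram_def Cons row_def)
    ultimately show ?thesis using that by auto
  qed
  have disj: "?T t \<inter> ?T u = {}" if "t \<in> {?s..n}" "u \<in> {?s..n}" "t \<noteq> u" for t u
  proof -
    have "row (n - t) = row (n - u)" if "T \<in> ?T t" "T \<in> ?T u" for T
      using zero_boxes[OF that(1)] zero_boxes[OF that(2)] sub \<open>t \<in> _\<close> \<open>u \<in> _\<close> by auto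
    moreover have "row (n - t) \<noteq> row (n - u)"
      using that by (metis atLeastAtMost_iff card_row diff_diff_cancel)
    ultimately show ?thesis by blast
  qed
  have "card (\<Union>t\<in>{?s..n}. ?T t) = (\<Sum>t\<in>{?s..n}. card (?T t))"
    by (rule card_UN_disjoint) (use disj card_set_partition_tableaux[OF lam] in auto)
  also have "\<dots> = (\<Sum>t\<in>{?s..n}. ?X t)"
    by (intro sum.cong refl) (use card_set_partition_tableaux[OF lam] in auto)
  \<comment> \<open>For smaller \<open>t\<close> the row of zeros does not fit into the first row of \<open>lam\<close>.\<close>
  also have "\<dots> = (\<Sum>t\<le>n. ?X t)"
    by (rule sum.mono_neutral_left) (use sub in \<open>auto simp: up_pow_delta_not_subset\<close>)
  also have "\<dots> = ((\<lambda>g. up (down g)) ^^ k) (delta (row n)) ?D"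
    by (rule up_down_pow_row[symmetric]) (rule partition_facts(1)[OF lam])
  also have "\<dots> = card ?V" using card_vacillating_tableaux[OF assms(1) lam] by simp
  finally have "card ?V = card (\<Union>t\<in>{?s..n}. ?T t)" by simp
  moreover have "finite ?V" using card_vacillating_tableaux[OF assms(1) lam] by blast
  moreover have "finite (\<Union>t\<in>{?s..n}. ?T t)" using card_set_partition_tableaux[OF lam] by auto
  ultimately show ?thesis by (intro finite_same_card_bij)
qed

end
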